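(* Let $s\in(0,1)$. There exists a positive constant $\gamma$ such that the following holds. Let $J\subseteq\mathbb{R}$ be an interval and let $\varphi:\mathbb{R}\to\mathbb{R}$ be a bounded, locally $C^{\bar\gamma}$ function for some $\bar\gamma$ with $s<\bar\gamma\le1$. If $\mathbf{D}^s\varphi=0$ in $J$ and $\varphi\ge 0$ in $\mathbb{R}$, then $$\sup_{[t_0-\frac34\delta,\;t_0-\frac14\delta]}\varphi\;\le\;\gamma\inf_{[t_0+\frac34\delta,\;t_0+\delta]}\varphi$$ for every $t_0\in\mathbb{R}$ and every $\delta>0$ such that $[t_0-\delta,t_0+\delta]\subset J$.
   Context: For $s\in(0,1)$ the (left) Marchaud fractional derivative, with the multiplicative constant neglected, is $$\mathbf{D}^s\varphi(t):=\int_0^\infty\frac{\varphi(t)-\varphi(t-\tau)}{\tau^{s+1}}\,d\tau .$$ "Locally $C^{\bar\gamma}$" means locally Hölder continuous with exponent $\bar\gamma$ (locally Lipschitz when $\bar\gamma=1$). *)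

theory Defs
  imports "HOL-Analysis.Analysis"
begin

text \<open>The integral is a Lebesgue integral, with value 0 if the integrand is not integrable.
  For bounded, locally Hoelder continuous \<open>\<phi>\<close> with exponent larger than \<open>s\<close> the integrand
  is absolutely integrable, so this convention is not used for such \<open>\<phi>\<close>.\<close>

definition marchaud_deriv :: "real \<Rightarrow> (real \<Rightarrow> real) \<Rightarrow> real \<Rightarrow> real" where
  "marchaud_deriv s \<phi> t = (LBINT \<tau>:{0<..}. (\<phi> t - \<phi> (t - \<tau>)) / \<tau> powr (s + 1))"

definition hoelder_on :: "real \<Rightarrow> real set \<Rightarrow> (real \<Rightarrow> real) \<Rightarrow> bool" where
  "hoelder_on \<alpha> U \<phi> \<longleftrightarrow> (\<exists>C. \<forall>x\<in>U. \<forall>y\<in>U. \<bar>\<phi> x - \<phi> y\<bar> \<le> C * \<bar>x - y\<bar> powr \<alpha>)"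

definition locally_hoelder :: "real \<Rightarrow> (real \<Rightarrow> real) \<Rightarrow> bool" where
  "locally_hoelder \<alpha> \<phi> \<longleftrightarrow> (\<forall>K. compact K \<longrightarrow> hoelder_on \<alpha> K \<phi>)"

end

theory Submission
  imports Defs
begin

text \<open>Comparison at an extremal point. Let \<open>T = t0 - \<delta>\<close>, \<open>a = t0 + \<delta>/2\<close>, \<open>b = t0 + \<delta>\<close>, and let \<open>M\<close> be the
  integral of \<open>\<phi> y * (b - y) powr (-s-1)\<close> over \<open>y < a\<close>. Both sides of the Harnack inequality are
  compared with \<open>M\<close>. At a minimum point of \<open>\<phi> t - \<epsilon> * (t - a)\<close> on \<open>[a, b]\<close> with negative value, the
  equation bounds \<open>M\<close> by a multiple of \<open>\<epsilon>\<close>; hence \<open>\<phi>\<close> lies above the line \<open>c * M * (t - a)\<close>. At a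
  maximum point of \<open>\<phi> t * (t - T)\<close> on \<open>[T, t0]\<close>, the increments of \<open>\<phi>\<close> at small lags are controlled by
  those of \<open>K / (t - T)\<close>, where \<open>K\<close> is the maximum, and those at large lags by \<open>M\<close>; the equation then
  bounds \<open>K\<close> by a multiple of \<open>M\<close>.\<close>

section \<open>Power integrals on the half line and continuity of Hoelder functions\<close>

lemma has_bochner_integral_powr_near_0:
  fixes p r :: real
  assumes "p > -1" "r \<ge> 0"
  shows "has_bochner_integral lborel (\<lambda>x. x powr p * indicator {0<..r} x) (r powr (p + 1) / (p + 1))"
proof -
  let ?f = "\<lambda>x::real. x powr p * indicator {0<..r} x"
  have "(?f has_integral (r powr (p + 1) / (p + 1))) UNIV"
  proof -
    have "((\<lambda>x. if x \<in> {0..r} then x powr p else 0) has_integral (r powr (p + 1) / (p + 1))) UNIV"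
      using has_integral_powr_from_0[OF assms] by (simp only: has_integral_restrict_UNIV)
    moreover have "(\<lambda>x. if x \<in> {0..r} then x powr p else 0) = ?f"
      by (auto simp: fun_eq_iff indicator_def)
    ultimately show ?thesis by simp
  qed
  \<comment> \<open>Nonnegativity of the integrand turns the gauge integral into a Lebesgue
    integral.\<close>
  hence "integral\<^sup>N lborel ?f = ennreal (r powr (p + 1) / (p + 1))"
    by (intro nn_integral_has_integral_lborel) auto
  thus ?thesis using assms by (intro has_bochner_integral_nn_integral) auto
qed

lemma has_bochner_integral_powr_near_infinity:
  fixes q r :: real
  assumes "q < -1" "r > 0"
  shows "has_bochner_integral lborel (\<lambda>x. x powr q * indicator {r<..} x) (- (r powr (q + 1)) / (q + 1))"
proof -
  let ?f = "\<lambda>x::real. x powr q * indicator {r<..} x"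
  have "(?f has_integral (- (r powr (q + 1)) / (q + 1))) UNIV"
  proof -
    have "((\<lambda>x. x powr q) has_integral (- (r powr (q + 1)) / (q + 1))) {r<..}"
      by (rule iffD1[OF has_integral_spike_set_eq has_integral_powr_to_inf[OF assms]])
         (auto intro: negligible_subset[of "{r}"])
    hence "((\<lambda>x. if x \<in> {r<..} then x powr q else 0) has_integral (- (r powr (q + 1)) / (q + 1))) UNIV"
      by (simp only: has_integral_restrict_UNIV)
    moreover have "(\<lambda>x. if x \<in> {r<..} then x powr q else 0) = ?f"
      by (auto simp: fun_eq_iff indicator_def)
    ultimately show ?thesis by simp
  qed
  hence "integral\<^sup>N lborel ?f = ennreal (- (r powr (q + 1)) / (q + 1))"
    by (intro nn_integral_has_integral_lborel) auto
  moreover have "- (r powr (q + 1)) / (q + 1) \<ge> 0" using assms by (intro divide_nonpos_neg) auto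
  ultimately show ?thesis by (intro has_bochner_integral_nn_integral) auto
qed

text \<open>Both comparison functions below have this shape: a bound on an increment that is linear
  in the lag up to \<open>r\<close> and constant beyond, multiplied by
  \<open>x powr (-s - 1)\<close>.\<close>

lemma has_bochner_integral_powr_two_sided:
  fixes s r A B :: real
  assumes "0 < s" "s < 1" "r > 0"
  shows "has_bochner_integral lborel
    (\<lambda>x. A * (x powr (-s) * indicator {0<..r} x) + B * (x powr (-s - 1) * indicator {r<..} x))
    (A * (r powr (1 - s) / (1 - s)) + B * (r powr (-s) / s))"
  using has_bochner_integral_add[OF
      has_bochner_integral_mult_right[OF has_bochner_integral_powr_near_0[of "-s" r], of A]
      has_bochner_integral_mult_right[OF has_bochner_integral_powr_near_infinity[of "-s - 1" r], of B]]
    assms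
  by (simp add: add.commute)

lemma locally_hoelder_imp_continuous:
  assumes "locally_hoelder \<alpha> \<phi>" "\<alpha> > 0"
  shows "continuous_on UNIV \<phi>"
proof -
  have "isCont \<phi> t" for t
  proof -
    obtain C where C: "\<And>x y. x \<in> {t-1..t+1} \<Longrightarrow> y \<in> {t-1..t+1} \<Longrightarrow> \<bar>\<phi> x - \<phi> y\<bar> \<le> C * \<bar>x - y\<bar> powr \<alpha>"
      using assms(1) compact_Icc[of "t-1" "t+1"] unfolding locally_hoelder_def hoelder_on_def by meson
    have lim: "((\<lambda>x. C * \<bar>x - t\<bar> powr \<alpha>) \<longlongrightarrow> C * 0) (at t)"
    proof (intro tendsto_mult tendsto_const)
      have "((\<lambda>x. \<bar>x - t\<bar> powr \<alpha>) \<longlongrightarrow> \<bar>t - t\<bar> powr \<alpha>) (at t)"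
        by (intro tendsto_powr' tendsto_intros) (use assms in auto)
      thus "((\<lambda>x. \<bar>x - t\<bar> powr \<alpha>) \<longlongrightarrow> 0) (at t)" by simp
    qed
    have "eventually (\<lambda>x. norm (\<phi> x - \<phi> t) \<le> C * \<bar>x - t\<bar> powr \<alpha>) (at t)"
      unfolding eventually_at
    proof (intro exI[of _ 1] conjI ballI impI)
      fix x assume "x \<noteq> t \<and> dist x t < 1"
      thus "norm (\<phi> x - \<phi> t) \<le> C * \<bar>x - t\<bar> powr \<alpha>"
        using C[of x t] unfolding dist_real_def real_norm_def atLeastAtMost_iff by linarith
    qed simp
    hence "((\<lambda>x. \<phi> x - \<phi> t) \<longlongrightarrow> 0) (at t)"
      by (rule Lim_null_comparison) (use lim in simp)
    thus ?thesis by (simp add: isCont_def LIM_zero_iff)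
  qed
  thus ?thesis by (simp add: continuous_on_eq_continuous_at)
qed

section \<open>The Marchaud integrand\<close>

locale marchaud_function =
  fixes s \<alpha> :: real and \<phi> :: "real \<Rightarrow> real"
  assumes s: "0 < s" "s < 1" and \<alpha>: "s < \<alpha>"
    and bounded: "bounded (range \<phi>)" and hoelder: "locally_hoelder \<alpha> \<phi>"
    and nonneg: "\<phi> t \<ge> 0"
begin

lemma continuous: "continuous_on S \<phi>"
  using locally_hoelder_imp_continuous[OF hoelder] s \<alpha> continuous_on_subset by fastforce

lemma measurable [measurable]: "\<phi> \<in> borel_measurable borel"
  using continuous by (rule borel_measurable_continuous_onI)

definition kernel :: "real \<Rightarrow> real \<Rightarrow> real" where
  "kernel t \<tau> = indicator {0<..} \<tau> * ((\<phi> t - \<phi> (t - \<tau>)) * \<tau> powr (-s - 1))"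

lemma marchaud_deriv_eq: "marchaud_deriv s \<phi> t = integral\<^sup>L lborel (kernel t)"
proof -
  have "x / \<tau> powr (s + 1) = x * \<tau> powr (-s - 1)" for x \<tau> :: real
    using powr_minus_divide[of \<tau> "s + 1"] by simp
  thus ?thesis
    unfolding marchaud_deriv_def set_lebesgue_integral_def kernel_def by simp
qed

text \<open>For lags up to 1 the Hoelder bound leaves the exponent \<open>\<alpha> - s - 1\<close>,
  which exceeds -1; for larger lags boundedness of \<open>\<phi>\<close> leaves the integrable tail
  \<open>\<tau> powr (-s - 1)\<close>.\<close>

lemma kernel_integrable: "integrable lborel (kernel t)"
proof -
  obtain C where C: "\<And>x y. x \<in> {t-1..t} \<Longrightarrow> y \<in> {t-1..t} \<Longrightarrow> \<bar>\<phi> x - \<phi> y\<bar> \<le> C * \<bar>x - y\<bar> powr \<alpha>"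
    using hoelder compact_Icc[of "t-1" "t"] unfolding locally_hoelder_def hoelder_on_def by meson
  obtain B where B: "\<And>x. \<bar>\<phi> x\<bar> \<le> B"
    using bounded unfolding bounded_iff by auto
  let ?g = "\<lambda>\<tau>. C * (\<tau> powr (\<alpha> - s - 1) * indicator {0<..1} \<tau>) + 2 * B * (\<tau> powr (-s - 1) * indicator {1<..} \<tau>)"
  have "integrable lborel ?g"
    using has_bochner_integral_powr_near_0[of "\<alpha> - s - 1" 1]
      has_bochner_integral_powr_near_infinity[of "-s - 1" 1] s \<alpha>
    by (intro Bochner_Integration.integrable_add integrable_mult_right)
       (auto simp: has_bochner_integral_iff)
  moreover have "norm (kernel t \<tau>) \<le> norm (?g \<tau>)" for \<tau>
  proof -
    consider "\<tau> \<le> 0" | "0 < \<tau>" "\<tau> \<le> 1" | "1 < \<tau>" by linarith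
    thus ?thesis
    proof cases
      case 1
      thus ?thesis by (simp add: kernel_def)
    next
      case 2
      have "\<bar>\<phi> t - \<phi> (t - \<tau>)\<bar> \<le> C * \<tau> powr \<alpha>" using C[of t "t - \<tau>"] 2 by simp
      hence "\<bar>\<phi> t - \<phi> (t - \<tau>)\<bar> * \<tau> powr (-s - 1) \<le> C * \<tau> powr \<alpha> * \<tau> powr (-s - 1)"
        by (rule mult_right_mono) simp
      also have "\<dots> = C * \<tau> powr (\<alpha> - s - 1)" by (simp add: powr_add[symmetric] algebra_simps)
      also have "\<dots> \<le> \<bar>C\<bar> * \<tau> powr (\<alpha> - s - 1)" by (intro mult_right_mono) auto
      finally show ?thesis using 2 by (simp add: kernel_def abs_mult)
    next
      case 3
      have "\<bar>\<phi> t - \<phi> (t - \<tau>)\<bar> \<le> 2 * B" using B[of t] B[of "t - \<tau>"] by linarith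
      hence "\<bar>\<phi> t - \<phi> (t - \<tau>)\<bar> * \<tau> powr (-s - 1) \<le> 2 * B * \<tau> powr (-s - 1)"
        by (rule mult_right_mono) simp
      thus ?thesis using 3 by (simp add: kernel_def abs_mult)
    qed
  qed
  moreover have "kernel t \<in> borel_measurable lborel" unfolding kernel_def by measurable
  ultimately show ?thesis
    by (intro Bochner_Integration.integrable_bound[of lborel ?g "kernel t"]) auto
qed

section \<open>The weighted mass of the past\<close>

text \<open>The weight refers to the fixed point \<open>b\<close> and not to the extremal point, so
  that one mass serves both bounds wherever the extrema are attained.\<close>

definition past :: "real \<Rightarrow> real \<Rightarrow> real \<Rightarrow> real" where
  "past a b y = indicator {..<a} y * (\<phi> y * (b - y) powr (-s - 1))"

definition past_mass :: "real \<Rightarrow> real \<Rightarrow> real" where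
  "past_mass a b = integral\<^sup>L lborel (past a b)"

lemma past_nonneg: "past a b y \<ge> 0"
  using nonneg by (simp add: past_def)

lemma past_integrable:
  assumes "a < b"
  shows "integrable lborel (past a b)"
proof -
  obtain B where B: "\<And>x. \<bar>\<phi> x\<bar> \<le> B"
    using bounded unfolding bounded_iff by auto
  let ?h = "\<lambda>x. x powr (-s - 1) * indicator {b-a<..} x :: real"
  have "integrable lborel ?h"
    using has_bochner_integral_powr_near_infinity[of "-s - 1" "b - a"] s assms
    by (auto simp: has_bochner_integral_iff)
  hence "integrable lborel (\<lambda>y. B * ?h (b + (-1) * y))"
    by (intro integrable_mult_right lborel_integrable_real_affine) auto
  moreover have "norm (past a b y) \<le> norm (B * ?h (b + (-1) * y))" for y
  proof -
    have "norm (past a b y) = \<bar>\<phi> y\<bar> * ?h (b + (-1) * y)"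
      by (auto simp: past_def abs_mult indicator_def)
    also have "\<dots> \<le> B * ?h (b + (-1) * y)" using B by (intro mult_right_mono) auto
    finally show ?thesis by simp
  qed
  moreover have "past a b \<in> borel_measurable lborel" unfolding past_def by measurable
  ultimately show ?thesis
    by (intro Bochner_Integration.integrable_bound[of lborel "\<lambda>y. B * ?h (b + (-1) * y)" "past a b"]) auto
qed

text \<open>Reflection and translation preserve Lebesgue measure, so from every base point
  \<open>t\<close> the mass can be compared with \<open>kernel\<close> lag by lag.\<close>

lemma has_bochner_integral_past_reflected:
  assumes "a < b"
  shows "has_bochner_integral lborel (\<lambda>\<tau>. past a b (t - \<tau>)) (past_mass a b)"
  using lborel_integrable_real_affine[OF past_integrable[OF assms], of "-1" t]
    lborel_integral_real_affine[of "-1" "past a b" t]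
  by (simp add: has_bochner_integral_iff past_mass_def)

lemma past_mass_nonneg: "past_mass a b \<ge> 0"
  unfolding past_mass_def using past_nonneg by (intro integral_nonneg_AE) auto

section \<open>Comparison at the minimum and at the maximum\<close>

text \<open>If the bound failed, \<open>\<phi>\<close> would fall below a line through
  \<open>(a, 0)\<close> of slope \<open>\<epsilon>\<close> smaller than the claimed slope. The
  equation at the point lowest relative to that line gives \<open>past_mass a b \<le> \<epsilon> *
  (b - a) powr (1 - s) / (s * (1 - s))\<close>, so \<open>\<epsilon>\<close> is at least the claimed
  slope.\<close>

lemma lower_bound:
  assumes "a < b" and eq: "\<And>t. a \<le> t \<Longrightarrow> t \<le> b \<Longrightarrow> marchaud_deriv s \<phi> t = 0"
    and t: "a \<le> t" "t \<le> b"
  shows "\<phi> t \<ge> s * (1 - s) * past_mass a b * (b - a) powr (s - 1) * (t - a)"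
proof (rule ccontr)
  define L m where "L = b - a" and "m = s * (1 - s) * past_mass a b * L powr (s - 1)"
  assume "\<not> ?thesis"
  hence less: "\<phi> t < m * (t - a)" by (simp add: m_def L_def)
  have ta: "t > a" using less t nonneg[of t] by (cases "t = a") auto
  have "\<phi> t / (t - a) < m" using less ta by (simp add: field_simps)
  then obtain \<epsilon> where \<epsilon>: "\<phi> t / (t - a) < \<epsilon>" "\<epsilon> < m" using dense by blast
  have "\<phi> t / (t - a) \<ge> 0" using ta nonneg[of t] by simp
  hence \<epsilon>0: "\<epsilon> > 0" using \<epsilon> by linarith
  have L: "L > 0" using assms by (simp add: L_def)
  let ?w = "\<lambda>x. \<phi> x - \<epsilon> * (x - a)"
  have "continuous_on {a..b} ?w" by (intro continuous_intros continuous)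
  then obtain u where u: "u \<in> {a..b}" and umin: "\<And>x. x \<in> {a..b} \<Longrightarrow> ?w u \<le> ?w x"
    using continuous_attains_inf[of "{a..b}" ?w] assms(1) by auto
  have "?w t < 0" using \<epsilon>(1) ta by (simp add: field_simps)
  \<comment> \<open>The negative sign is used twice: it excludes \<open>u = a\<close>, and it bounds
    \<open>\<phi> u\<close> itself when the lag reaches below \<open>a\<close>.\<close>
  hence wu: "?w u < 0" using umin[of t] t by auto
  have ua: "u > a" using wu u nonneg[of u] by (cases "u = a") auto
  \<comment> \<open>The increment is bounded by \<open>\<epsilon> * min \<tau> L\<close>; the cap
    \<open>L\<close> comes from \<open>u - a \<le> L\<close>.\<close>
  let ?P = "\<lambda>\<tau>. \<epsilon> * (\<tau> powr (-s) * indicator {0<..L} \<tau>) + \<epsilon> * L * (\<tau> powr (-s - 1) * indicator {L<..} \<tau>)"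
  have intP: "has_bochner_integral lborel ?P
      (\<epsilon> * (L powr (1 - s) / (1 - s)) + \<epsilon> * L * (L powr (-s) / s))"
    by (rule has_bochner_integral_powr_two_sided) (use s L in auto)
  note intG = has_bochner_integral_past_reflected[OF assms(1), of u]
  have pw: "kernel u \<tau> \<le> ?P \<tau> - past a b (u - \<tau>)" for \<tau>
  proof (cases "\<tau> > 0")
    case False
    thus ?thesis using ua L by (simp add: kernel_def past_def)
  next
    case True
    let ?k = "\<tau> powr (-s - 1)"
    have P: "?P \<tau> = \<epsilon> * min \<tau> L * ?k"
    proof -
      have "\<tau> powr (-s) = \<tau> * ?k"
        using True powr_mult_base[of \<tau> "-s - 1"] by simp
      thus ?thesis using True by (simp add: indicator_def min_def)
    qed
    show ?thesis
    proof (cases "u - \<tau> < a")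
      case False
      \<comment> \<open>The lag stays inside \<open>{a..b}\<close>, so minimality of
        \<open>?w\<close> at \<open>u\<close> applies.\<close>
      have "\<phi> u - \<phi> (u - \<tau>) \<le> \<epsilon> * \<tau>" using umin[of "u - \<tau>"] False True u
        by (simp add: algebra_simps)
      moreover have "\<tau> \<le> L" using False u by (simp add: L_def)
      ultimately have "(\<phi> u - \<phi> (u - \<tau>)) * ?k \<le> \<epsilon> * min \<tau> L * ?k"
        by (intro mult_right_mono) (auto simp: min_def)
      thus ?thesis unfolding P using True False by (simp add: kernel_def past_def)
    next
      case less: True
      have "\<phi> u \<le> \<epsilon> * (u - a)" using wu by simp
      also have "\<dots> \<le> \<epsilon> * min \<tau> L" using less u \<epsilon>0 by (intro mult_left_mono) (auto simp: L_def)
      finally have "\<phi> u * ?k \<le> \<epsilon> * min \<tau> L * ?k" by (intro mult_right_mono) auto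
      \<comment> \<open>As \<open>u \<le> b\<close>, measuring the distance from \<open>b\<close>
        only lowers the weight.\<close>
      moreover have "(b - (u - \<tau>)) powr (-s - 1) \<le> ?k"
        using True u s by (intro powr_mono2') auto
      hence "\<phi> (u - \<tau>) * (b - (u - \<tau>)) powr (-s - 1) \<le> \<phi> (u - \<tau>) * ?k"
        using nonneg by (intro mult_left_mono) auto
      moreover have "kernel u \<tau> = \<phi> u * ?k - \<phi> (u - \<tau>) * ?k"
        using True by (simp add: kernel_def left_diff_distrib)
      moreover have "past a b (u - \<tau>) = \<phi> (u - \<tau>) * (b - (u - \<tau>)) powr (-s - 1)"
        using less by (simp add: past_def)
      ultimately show ?thesis unfolding P by linarith
    qed
  qed
  have "0 = integral\<^sup>L lborel (kernel u)" using eq[of u] u marchaud_deriv_eq by simp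
  also have "\<dots> \<le> (\<integral>\<tau>. ?P \<tau> - past a b (u - \<tau>) \<partial>lborel)"
    using has_bochner_integral_diff[OF intP intG]
    by (intro integral_mono kernel_integrable pw) (simp add: has_bochner_integral_iff)
  also have "\<dots> = \<epsilon> * (L powr (1 - s) / (1 - s)) + \<epsilon> * L * (L powr (-s) / s) - past_mass a b"
    using has_bochner_integral_diff[OF intP intG] by (rule has_bochner_integral_integral_eq)
  finally have "past_mass a b \<le> \<epsilon> * (L powr (1 - s) / (1 - s)) + \<epsilon> * (L * L powr (-s)) / s" by simp
  also have "L * L powr (-s) = L powr (1 - s)" using L powr_mult_base[of L "-s"] by simp
  also have "\<epsilon> * (L powr (1 - s) / (1 - s)) + \<epsilon> * (L powr (1 - s)) / s = \<epsilon> * L powr (1 - s) / (s * (1 - s))"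
    using s by (simp add: field_simps)
  finally have "s * (1 - s) * past_mass a b \<le> \<epsilon> * L powr (1 - s)"
    using s by (simp add: field_simps)
  hence "s * (1 - s) * past_mass a b * L powr (s - 1) \<le> \<epsilon> * L powr (1 - s) * L powr (s - 1)"
    by (rule mult_right_mono) simp
  also have "\<dots> = \<epsilon>" using L by (simp add: powr_add[symmetric] mult.assoc)
  finally show False using \<epsilon>(2) by (simp add: m_def)
qed

text \<open>The weight \<open>t - T\<close> vanishes at the left end, so the maximum lies at
  positive distance \<open>h\<close> from \<open>T\<close> unless it is 0. Lags below a fraction of
  \<open>h\<close> stay to the right of \<open>T\<close>, where maximality controls
  \<open>\<phi>\<close>; whatever lies further back, before \<open>T\<close> included, is absorbed
  into the past mass.\<close>

lemma upper_bound:
  assumes "\<delta> > 0" "T + \<delta> \<le> a" "a < b" "b \<le> T + 2 * \<delta>"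
    and eq: "\<And>t. T \<le> t \<Longrightarrow> t \<le> T + \<delta> \<Longrightarrow> marchaud_deriv s \<phi> t = 0"
    and t: "T \<le> t" "t \<le> T + \<delta>"
  shows "\<phi> t * (t - T) \<le> 8 * s / (1 - s) * (3 * \<delta>) powr (s + 1) * past_mass a b"
proof -
  have "continuous_on {T..T+\<delta>} (\<lambda>x. \<phi> x * (x - T))" by (intro continuous_intros continuous)
  then obtain u where u: "u \<in> {T..T+\<delta>}"
    and umax: "\<And>x. x \<in> {T..T+\<delta>} \<Longrightarrow> \<phi> x * (x - T) \<le> \<phi> u * (u - T)"
    using continuous_attains_sup[of "{T..T+\<delta>}" "\<lambda>x. \<phi> x * (x - T)"] assms(1) by auto
  define K h where "K = \<phi> u * (u - T)" and "h = u - T"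
  have K0: "K \<ge> 0" using u nonneg by (simp add: K_def)
  have "K \<le> 8 * s / (1 - s) * (3 * \<delta>) powr (s + 1) * past_mass a b"
  proof (cases "u = T")
    case True
    thus ?thesis using s past_mass_nonneg by (simp add: K_def)
  next
    case False
    have h: "0 < h" "h \<le> \<delta>" using u False by (auto simp: h_def)
    \<comment> \<open>chosen so that the contribution of the lags below \<open>r\<close> is at most half that of \<open>\<phi> u\<close> at the lags above \<open>r\<close>\<close>
    define \<rho> r where "\<rho> = (1 - s) / 4" and "r = \<rho> * h"
    have \<rho>: "0 < \<rho>" "\<rho> \<le> 1/4" using s by (auto simp: \<rho>_def)
    have r: "0 < r" "r \<le> h / 4" using \<rho> h mult_right_mono[of \<rho> "1/4" h] by (auto simp: r_def)
    have phiu: "\<phi> u = K / h" using h by (simp add: K_def h_def)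
    \<comment> \<open>For lags above \<open>r\<close>,
      \<open>b - (u - \<tau>) \<le> \<tau> * (3 * \<delta> / r)\<close>; \<open>Q\<close> is the
      resulting price for replacing the weight of the lag by that of \<open>past\<close>.\<close>
    define Q where "Q = (3 * \<delta> / r) powr (s + 1)"
    let ?P = "\<lambda>\<tau>. - (2 * K / h\<^sup>2) * (\<tau> powr (-s) * indicator {0<..r} \<tau>)
        + K / h * (\<tau> powr (-s - 1) * indicator {r<..} \<tau>)"
    have intP: "has_bochner_integral lborel ?P
        (- (2 * K / h\<^sup>2) * (r powr (1 - s) / (1 - s)) + K / h * (r powr (-s) / s))"
      by (rule has_bochner_integral_powr_two_sided) (use s r in auto)
    have intG: "has_bochner_integral lborel (\<lambda>\<tau>. Q * past a b (u - \<tau>)) (Q * past_mass a b)"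
      by (intro has_bochner_integral_mult_right has_bochner_integral_past_reflected assms)
    have pw: "?P \<tau> - Q * past a b (u - \<tau>) \<le> kernel u \<tau>" for \<tau>
    proof -
      let ?k = "\<tau> powr (-s - 1)"
      have Qp: "0 \<le> Q * past a b (u - \<tau>)" using past_nonneg by (simp add: Q_def)
      consider "\<tau> \<le> 0" | "0 < \<tau>" "\<tau> \<le> r" | "r < \<tau>" by linarith
      thus ?thesis
      proof cases
        case 1
        thus ?thesis using Qp r by (simp add: kernel_def)
      next
        case 2
        \<comment> \<open>Here \<open>h - \<tau>\<close> is the distance of
          \<open>u - \<tau>\<close> from \<open>T\<close>. Keeping it above \<open>h / 2\<close>
          bounds the increment of \<open>K / (t - T)\<close> by \<open>2 * K * \<tau>\<close> over
          the square of \<open>h\<close>.\<close>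
        have h\<tau>: "h - \<tau> \<ge> h / 2" "h - \<tau> > 0" using 2 r h by linarith+
        have "\<phi> (u - \<tau>) * (h - \<tau>) \<le> K"
          using umax[of "u - \<tau>"] u 2 h\<tau> by (simp add: K_def h_def algebra_simps)
        hence "\<phi> (u - \<tau>) \<le> K / (h - \<tau>)" using h\<tau> by (simp add: field_simps)
        moreover have "K / h - K / (h - \<tau>) = - (K * \<tau> / (h * (h - \<tau>)))"
          using h h\<tau> by (simp add: field_simps)
        moreover have "K * \<tau> / (h * (h - \<tau>)) \<le> K * \<tau> / (h * (h / 2))"
          using K0 2 h h\<tau> by (intro divide_left_mono mult_left_mono) auto
        moreover have "K * \<tau> / (h * (h / 2)) = 2 * K / h\<^sup>2 * \<tau>"
          by (simp add: power2_eq_square)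
        ultimately have "- (2 * K / h\<^sup>2) * \<tau> \<le> \<phi> u - \<phi> (u - \<tau>)" using phiu by linarith
        hence "- (2 * K / h\<^sup>2) * \<tau> * ?k \<le> (\<phi> u - \<phi> (u - \<tau>)) * ?k"
          by (intro mult_right_mono) auto
        moreover have "\<tau> powr (-s) = \<tau> * ?k" using 2 powr_mult_base[of \<tau> "-s - 1"] by simp
        ultimately show ?thesis using Qp 2 by (simp add: kernel_def mult.assoc)
      next
        case 3
        have "b - (u - \<tau>) \<le> \<tau> + 2 * \<delta>" using u assms by auto
        also have "\<dots> \<le> \<tau> * (3 * \<delta> / r)"
        proof -
          have "r \<le> \<delta>" using r h by linarith
          hence "\<tau> * r \<le> \<tau> * \<delta>" "2 * \<delta> * r \<le> 2 * \<delta> * \<tau>" using 3 r assms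
            by (auto intro!: mult_left_mono)
          hence "(\<tau> + 2 * \<delta>) * r \<le> \<tau> * (3 * \<delta>)" by (simp add: algebra_simps)
          thus ?thesis using r by (simp add: field_simps)
        qed
        finally have le: "b - (u - \<tau>) \<le> \<tau> * (3 * \<delta> / r)" .
        \<comment> \<open>Since \<open>u \<le> T + \<delta> \<le> a\<close>, every positive lag
          lands in the region seen by \<open>past\<close>.\<close>
        have pos: "b - (u - \<tau>) > 0" and lt: "u - \<tau> < a" using u assms 3 r by auto
        have "(\<tau> * (3 * \<delta> / r)) powr (-s - 1) \<le> (b - (u - \<tau>)) powr (-s - 1)"
          using le pos s by (intro powr_mono2') auto
        hence "Q * (\<tau> * (3 * \<delta> / r)) powr (-s - 1) \<le> Q * (b - (u - \<tau>)) powr (-s - 1)"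
          by (intro mult_left_mono) (auto simp: Q_def)
        moreover have "Q * (\<tau> * (3 * \<delta> / r)) powr (-s - 1) = ?k"
        proof -
          have "(3 * \<delta> / r) powr (s + 1) * (3 * \<delta> / r) powr (-s - 1) = 1"
            using r assms by (simp add: powr_add[symmetric])
          moreover have "(\<tau> * (3 * \<delta> / r)) powr (-s - 1) = ?k * (3 * \<delta> / r) powr (-s - 1)"
            by (rule powr_mult)
          ultimately show ?thesis by (simp add: Q_def)
        qed
        ultimately have "\<phi> (u - \<tau>) * ?k \<le> \<phi> (u - \<tau>) * (Q * (b - (u - \<tau>)) powr (-s - 1))"
          using nonneg by (intro mult_left_mono) auto
        thus ?thesis using 3 r lt phiu
          by (simp add: kernel_def past_def left_diff_distrib mult.left_commute)
      qed
    qed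
    have "- (2 * K / h\<^sup>2) * (r powr (1 - s) / (1 - s)) + K / h * (r powr (-s) / s) - Q * past_mass a b
        = (\<integral>\<tau>. ?P \<tau> - Q * past a b (u - \<tau>) \<partial>lborel)"
      using has_bochner_integral_diff[OF intP intG] by (rule has_bochner_integral_integral_eq[symmetric])
    also have "\<dots> \<le> integral\<^sup>L lborel (kernel u)"
      using has_bochner_integral_diff[OF intP intG]
      by (intro integral_mono kernel_integrable pw) (simp add: has_bochner_integral_iff)
    also have "\<dots> = 0" using eq[of u] u marchaud_deriv_eq by simp
    finally have main: "K / h * (r powr (-s) / s) - 2 * K / h\<^sup>2 * (r powr (1 - s) / (1 - s)) \<le> Q * past_mass a b"
      by simp
    have near: "2 * K / h\<^sup>2 * (r powr (1 - s) / (1 - s)) = K / h * r powr (-s) / 2"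
    proof -
      have "r powr (1 - s) = r * r powr (-s)" using r powr_mult_base[of r "-s"] by simp
      moreover have "r / (1 - s) = h / 4" using s by (simp add: r_def \<rho>_def divide_eq_eq)
      ultimately have *: "r powr (1 - s) / (1 - s) = h / 4 * r powr (-s)"
        by (metis times_divide_eq_left)
      show ?thesis unfolding * using h by (simp add: power2_eq_square)
    qed
    \<comment> \<open>Because \<open>s < 1\<close>, the near loss \<open>1 / 2\<close> is at most
      half of the far gain \<open>1 / s\<close>.\<close>
    have "K / h * r powr (-s) / (2 * s) \<le> K / h * (r powr (-s) / s) - K / h * r powr (-s) / 2"
    proof -
      have "K / h * r powr (-s) * (1 / (2 * s)) \<le> K / h * r powr (-s) * (1 / s - 1 / 2)"
        using K0 h s by (intro mult_left_mono) (auto simp: field_simps)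
      thus ?thesis by (simp add: algebra_simps)
    qed
    hence "K / h * r powr (-s) / (2 * s) \<le> Q * past_mass a b" using main near by linarith
    \<comment> \<open>The factor \<open>r powr (-s)\<close> now cancels and only the constant ratio
      \<open>h / r\<close> survives, so the bound does not depend on where the maximum lies.\<close>
    moreover have "Q = (3 * \<delta>) powr (s + 1) * (r powr (-s) / r)"
    proof -
      have "r powr (-s) / r = 1 / r powr (s + 1)" using r by (simp add: powr_add powr_minus field_simps)
      thus ?thesis using r assms by (simp add: Q_def powr_divide)
    qed
    ultimately have "r powr (-s) * (K / (2 * s * h)) \<le> r powr (-s) * ((3 * \<delta>) powr (s + 1) * past_mass a b / r)"
      by (simp add: mult_ac)
    hence "K / (2 * s * h) \<le> (3 * \<delta>) powr (s + 1) * past_mass a b / r"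
      by (rule mult_left_le_imp_le) (use r in simp)
    hence "K \<le> 2 * s * h / r * ((3 * \<delta>) powr (s + 1) * past_mass a b)"
      using s h r by (simp add: field_simps)
    also have "2 * s * h / r = 8 * s / (1 - s)" using h s by (simp add: r_def \<rho>_def)
    finally show ?thesis by (simp add: mult.assoc)
  qed
  thus ?thesis using umax[of t] t by (simp add: K_def)
qed

section \<open>The Harnack inequality\<close>

text \<open>Both bounds are linked by the quantity \<open>\<delta> powr s * M\<close>, so
  \<open>\<delta>\<close> drops out. The number 128 is 8 from \<open>upper_bound\<close> times two
  factors 4, as \<open>x\<close> and \<open>y\<close> lie at least \<open>\<delta> / 4\<close>
  beyond \<open>t0 - \<delta>\<close> and \<open>a\<close>. The factor \<open>s\<close> of the upper
  bound cancels that of the lower one.\<close>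

lemma harnack:
  assumes "\<delta> > 0" and eq: "\<And>t. t0 - \<delta> \<le> t \<Longrightarrow> t \<le> t0 + \<delta> \<Longrightarrow> marchaud_deriv s \<phi> t = 0"
    and x: "t0 - 3/4 * \<delta> \<le> x" "x \<le> t0 - 1/4 * \<delta>" and y: "t0 + 3/4 * \<delta> \<le> y" "y \<le> t0 + \<delta>"
  shows "\<phi> x \<le> 128 * 3 powr (s + 1) * 2 powr (s - 1) / (1 - s)\<^sup>2 * \<phi> y"
proof -
  define a b where "a = t0 + \<delta> / 2" and "b = t0 + \<delta>"
  define M where "M = past_mass a b"
  have M0: "M \<ge> 0" by (simp add: M_def past_mass_nonneg)
  have "\<phi> x * (x - (t0 - \<delta>)) \<le> 8 * s / (1 - s) * (3 * \<delta>) powr (s + 1) * M"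
    unfolding M_def by (rule upper_bound[of \<delta>]) (use assms in \<open>auto simp: a_def b_def\<close>)
  moreover have "\<phi> x * (\<delta> / 4) \<le> \<phi> x * (x - (t0 - \<delta>))"
    using x nonneg by (intro mult_left_mono) auto
  ultimately have "\<phi> x * (\<delta> / 4) \<le> 8 * s / (1 - s) * (3 * \<delta>) powr (s + 1) * M" by linarith
  moreover have "(3 * \<delta>) powr (s + 1) = 3 powr (s + 1) * (\<delta> powr s * \<delta>)"
    using assms(1) by (simp add: powr_mult powr_add)
  ultimately have "\<delta> * \<phi> x \<le> \<delta> * (32 * s / (1 - s) * 3 powr (s + 1) * (\<delta> powr s * M))"
    by (simp add: mult_ac)
  hence up: "\<phi> x \<le> 32 * s / (1 - s) * 3 powr (s + 1) * (\<delta> powr s * M)"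
    using assms(1) mult_le_cancel_left_pos by blast
  have "s * (1 - s) * M * (b - a) powr (s - 1) * (y - a) \<le> \<phi> y"
    unfolding M_def by (rule lower_bound) (use assms in \<open>auto simp: a_def b_def\<close>)
  moreover have "s * (1 - s) * M * (b - a) powr (s - 1) * (\<delta> / 4) \<le> s * (1 - s) * M * (b - a) powr (s - 1) * (y - a)"
    using y s M0 by (intro mult_left_mono) (auto simp: a_def)
  ultimately have "s * (1 - s) * M * (b - a) powr (s - 1) * (\<delta> / 4) \<le> \<phi> y"
    by (rule order_trans[rotated])
  hence "s * (1 - s) * M * ((b - a) powr (s - 1) * \<delta>) \<le> 4 * \<phi> y"
    by (simp add: mult.assoc)
  also have "(b - a) powr (s - 1) * \<delta> = \<delta> powr s / 2 powr (s - 1)"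
  proof -
    have "(b - a) powr (s - 1) = \<delta> powr (s - 1) / 2 powr (s - 1)"
      using assms(1) by (simp add: a_def b_def powr_divide)
    thus ?thesis using assms(1) powr_mult_base[of \<delta> "s - 1"] by (simp add: mult.commute)
  qed
  finally have "\<delta> powr s * M \<le> 4 * 2 powr (s - 1) / (s * (1 - s)) * \<phi> y"
    using s by (simp add: field_simps)
  hence "32 * s / (1 - s) * 3 powr (s + 1) * (\<delta> powr s * M)
      \<le> 32 * s / (1 - s) * 3 powr (s + 1) * (4 * 2 powr (s - 1) / (s * (1 - s)) * \<phi> y)"
    using s by (intro mult_left_mono) auto
  also have "\<dots> = 128 * 3 powr (s + 1) * 2 powr (s - 1) / (1 - s)\<^sup>2 * \<phi> y"
    using s by (simp add: power2_eq_square)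
  finally show ?thesis using up by linarith
qed

end

theorem theorem1p3:
  fixes s :: real
  assumes "0 < s" and "s < 1"
  shows "\<exists>\<gamma>::real. \<gamma> > 0 \<and>
    (\<forall>(J::real set) (\<phi>::real \<Rightarrow> real) (\<alpha>::real).
       is_interval J \<longrightarrow> bounded (range \<phi>) \<longrightarrow>
       s < \<alpha> \<longrightarrow> \<alpha> \<le> 1 \<longrightarrow> locally_hoelder \<alpha> \<phi> \<longrightarrow>
       (\<forall>t\<in>J. marchaud_deriv s \<phi> t = 0) \<longrightarrow> (\<forall>t. \<phi> t \<ge> 0) \<longrightarrow>
       (\<forall>(t0::real) (\<delta>::real). \<delta> > 0 \<longrightarrow> {t0 - \<delta>..t0 + \<delta>} \<subseteq> J \<longrightarrow>
          (SUP t\<in>{t0 - 3/4 * \<delta>..t0 - 1/4 * \<delta>}. \<phi> t)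
            \<le> \<gamma> * (INF t\<in>{t0 + 3/4 * \<delta>..t0 + \<delta>}. \<phi> t)))"
proof -
  define \<gamma> where "\<gamma> = 128 * 3 powr (s + 1) * 2 powr (s - 1) / (1 - s)\<^sup>2"
  have \<gamma>: "\<gamma> > 0" using assms by (simp add: \<gamma>_def)
  show ?thesis
  proof (intro exI[of _ \<gamma>] conjI \<gamma> allI impI)
    fix J :: "real set" and \<phi> :: "real \<Rightarrow> real" and \<alpha> t0 \<delta> :: real
    assume "bounded (range \<phi>)" "s < \<alpha>" "locally_hoelder \<alpha> \<phi>" "\<forall>t. \<phi> t \<ge> 0"
      and eq: "\<forall>t\<in>J. marchaud_deriv s \<phi> t = 0" and \<delta>: "\<delta> > 0" and J: "{t0 - \<delta>..t0 + \<delta>} \<subseteq> J"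
    then interpret marchaud_function s \<alpha> \<phi>
      using assms by unfold_locales auto
    let ?X = "{t0 - 3/4 * \<delta>..t0 - 1/4 * \<delta>}" and ?Y = "{t0 + 3/4 * \<delta>..t0 + \<delta>}"
    \<comment> \<open>Dividing by \<open>\<gamma>\<close> isolates the infimum, which reduces the
      claim to single points \<open>y\<close>.\<close>
    have "(SUP t\<in>?X. \<phi> t) / \<gamma> \<le> (INF t\<in>?Y. \<phi> t)"
    proof (intro cINF_greatest)
      fix y assume y: "y \<in> ?Y"
      have "(SUP t\<in>?X. \<phi> t) \<le> \<gamma> * \<phi> y"
        unfolding \<gamma>_def using y \<delta> eq J by (intro cSUP_least harnack[of \<delta> t0]) auto
      thus "(SUP t\<in>?X. \<phi> t) / \<gamma> \<le> \<phi> y" using \<gamma> by (simp add: field_simps)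
    qed (use \<delta> in auto)
    thus "(SUP t\<in>?X. \<phi> t) \<le> \<gamma> * (INF t\<in>?Y. \<phi> t)" using \<gamma> by (simp add: field_simps)
  qed
qed

end
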